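(* Let $\mathcal A$ be a variety satisfying the congruence extension property, with distinguished constants $0,1$. If $I$ is a self-injective maximum simple algebra in $\mathcal A$, then $I$ is injective in $\mathcal A$.
   Context: Two constant terms $0,1$ of the language of a variety $\mathcal V$ are distinguished constants if $A\models0\neq1$ for every nontrivial (more than one element) algebra $A\in\mathcal V$. An algebra $A$ has the congruence extension property if for every subalgebra $B$ of $A$ and every congruence $\theta$ of $B$ there is a congruence $\phi$ of $A$ with $\theta=\phi\cap B^2$; a variety satisfies it if all its algebras do. An algebra is simple if its only congruences are $\Delta$ and $\nabla$. A simple algebra $I_M\in\mathcal A$ is maximum simple if every simple algebra in $\mathcal A$ embeds into $I_M$. An algebra $A$ is self-injective if every homomorphism from a subalgebra of $A$ into $A$ extends to an endomorphism of $A$. $A\in\mathcal A$ is injective in $\mathcal A$ if for every injective homomorphism $f:B\to C$ with $B,C\in\mathcal A$ and every homomorphism $g:B\to A$ there is a homomorphism $h:C\to A$ with $h\circ f=g$. *)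

theory Defs
  imports Main
begin

text \<open>
  A language is a type \<open>'f\<close> of operation symbols together with a finitary arity function
  \<open>ar :: 'f \<Rightarrow> nat\<close>. An algebra has a carrier set inside a type \<open>'a\<close>; its operations are total
  functions on lists, of which only the values on lists over the carrier of length \<open>ar f\<close> matter.
  The type \<open>'a\<close> plays the role of the universe: a class of algebras is a set of algebras whose
  carriers are subsets of \<open>'a\<close>, and \<open>'a\<close> is arbitrary.
\<close>

record ('f, 'a) algebra =
  univ :: "'a set"
  oper :: "'f \<Rightarrow> 'a list \<Rightarrow> 'a"

definition algebra :: "('f \<Rightarrow> nat) \<Rightarrow> ('f, 'a) algebra \<Rightarrow> bool" where
  "algebra ar A \<longleftrightarrow> univ A \<noteq> {} \<and>
     (\<forall>f xs. length xs = ar f \<and> set xs \<subseteq> univ A \<longrightarrow> oper A f xs \<in> univ A)"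

definition nontrivial :: "('f, 'a) algebra \<Rightarrow> bool" where
  "nontrivial A \<longleftrightarrow> (\<exists>x\<in>univ A. \<exists>y\<in>univ A. x \<noteq> y)"

subsection \<open>Terms, equations and varieties\<close>

datatype 'f trm = Var nat | App 'f "'f trm list"

primrec wf_trm :: "('f \<Rightarrow> nat) \<Rightarrow> 'f trm \<Rightarrow> bool" where
  "wf_trm ar (Var n) \<longleftrightarrow> True"
| "wf_trm ar (App f ts) \<longleftrightarrow> length ts = ar f \<and> list_all id (map (wf_trm ar) ts)"

primrec vars_trm :: "'f trm \<Rightarrow> nat set" where
  "vars_trm (Var n) = {n}"
| "vars_trm (App f ts) = \<Union> (set (map vars_trm ts))"

primrec eval :: "('f, 'a) algebra \<Rightarrow> (nat \<Rightarrow> 'a) \<Rightarrow> 'f trm \<Rightarrow> 'a" where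
  "eval A v (Var n) = v n"
| "eval A v (App f ts) = oper A f (map (eval A v) ts)"

definition satisfies :: "('f, 'a) algebra \<Rightarrow> 'f trm \<times> 'f trm \<Rightarrow> bool" where
  "satisfies A e \<longleftrightarrow> (\<forall>v. range v \<subseteq> univ A \<longrightarrow> eval A v (fst e) = eval A v (snd e))"

definition variety :: "('f \<Rightarrow> nat) \<Rightarrow> ('f, 'a) algebra set \<Rightarrow> bool" where
  "variety ar K \<longleftrightarrow>
     (\<exists>E. (\<forall>(s, t)\<in>E. wf_trm ar s \<and> wf_trm ar t) \<and>
          K = {A. algebra ar A \<and> (\<forall>e\<in>E. satisfies A e)})"

definition constant_trm :: "('f \<Rightarrow> nat) \<Rightarrow> 'f trm \<Rightarrow> bool" where
  "constant_trm ar t \<longleftrightarrow> wf_trm ar t \<and> vars_trm t = {}"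

text \<open>The valuation \<open>v\<close> is irrelevant, since constant terms contain no variables.\<close>

definition distinguished_constants ::
    "('f \<Rightarrow> nat) \<Rightarrow> ('f, 'a) algebra set \<Rightarrow> 'f trm \<Rightarrow> 'f trm \<Rightarrow> bool" where
  "distinguished_constants ar K c0 c1 \<longleftrightarrow>
     constant_trm ar c0 \<and> constant_trm ar c1 \<and>
     (\<forall>A\<in>K. nontrivial A \<longrightarrow>
        (\<forall>v. range v \<subseteq> univ A \<longrightarrow> eval A v c0 \<noteq> eval A v c1))"

subsection \<open>Subalgebras, homomorphisms and congruences\<close>

definition subuniverse :: "('f \<Rightarrow> nat) \<Rightarrow> ('f, 'a) algebra \<Rightarrow> 'a set \<Rightarrow> bool" where
  "subuniverse ar A S \<longleftrightarrow> S \<noteq> {} \<and> S \<subseteq> univ A \<and>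
     (\<forall>f xs. length xs = ar f \<and> set xs \<subseteq> S \<longrightarrow> oper A f xs \<in> S)"

definition subalgebra :: "('f \<Rightarrow> nat) \<Rightarrow> ('f, 'a) algebra \<Rightarrow> ('f, 'a) algebra \<Rightarrow> bool" where
  "subalgebra ar B A \<longleftrightarrow> (\<exists>S. subuniverse ar A S \<and> B = A\<lparr>univ := S\<rparr>)"

definition homomorphism ::
    "('f \<Rightarrow> nat) \<Rightarrow> ('f, 'a) algebra \<Rightarrow> ('f, 'b) algebra \<Rightarrow> ('a \<Rightarrow> 'b) \<Rightarrow> bool" where
  "homomorphism ar A B h \<longleftrightarrow> h ` univ A \<subseteq> univ B \<and>
     (\<forall>f xs. length xs = ar f \<and> set xs \<subseteq> univ A \<longrightarrow>
        h (oper A f xs) = oper B f (map h xs))"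

definition embedding ::
    "('f \<Rightarrow> nat) \<Rightarrow> ('f, 'a) algebra \<Rightarrow> ('f, 'b) algebra \<Rightarrow> ('a \<Rightarrow> 'b) \<Rightarrow> bool" where
  "embedding ar A B h \<longleftrightarrow> homomorphism ar A B h \<and> inj_on h (univ A)"

definition congruence :: "('f \<Rightarrow> nat) \<Rightarrow> ('f, 'a) algebra \<Rightarrow> ('a \<times> 'a) set \<Rightarrow> bool" where
  "congruence ar A \<theta> \<longleftrightarrow> equiv (univ A) \<theta> \<and>
     (\<forall>f xs ys. length xs = ar f \<and> length ys = ar f \<and>
        (\<forall>i<ar f. (xs ! i, ys ! i) \<in> \<theta>) \<longrightarrow> (oper A f xs, oper A f ys) \<in> \<theta>)"

definition CEP :: "('f \<Rightarrow> nat) \<Rightarrow> ('f, 'a) algebra \<Rightarrow> bool" where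
  "CEP ar A \<longleftrightarrow>
     (\<forall>B \<theta>. subalgebra ar B A \<and> congruence ar B \<theta> \<longrightarrow>
        (\<exists>\<phi>. congruence ar A \<phi> \<and> \<theta> = \<phi> \<inter> univ B \<times> univ B))"

subsection \<open>Simple and injective algebras\<close>

definition simple :: "('f \<Rightarrow> nat) \<Rightarrow> ('f, 'a) algebra \<Rightarrow> bool" where
  "simple ar A \<longleftrightarrow>
     (\<forall>\<theta>. congruence ar A \<theta> \<longrightarrow> \<theta> = Id_on (univ A) \<or> \<theta> = univ A \<times> univ A)"

text \<open>
  One-element algebras satisfy \<open>simple\<close>, but when there are distinguished constants they do not
  embed into any nontrivial algebra. Hence only the nontrivial simple algebras are required to
  embed into a maximum simple algebra; otherwise only one-element algebras could be maximum simple.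
  No nontriviality is imposed on \<open>M\<close> itself.
\<close>

definition maximum_simple ::
    "('f \<Rightarrow> nat) \<Rightarrow> ('f, 'a) algebra set \<Rightarrow> ('f, 'a) algebra \<Rightarrow> bool" where
  "maximum_simple ar K M \<longleftrightarrow> M \<in> K \<and> simple ar M \<and>
     (\<forall>S\<in>K. simple ar S \<and> nontrivial S \<longrightarrow> (\<exists>h. embedding ar S M h))"

definition self_injective :: "('f \<Rightarrow> nat) \<Rightarrow> ('f, 'a) algebra \<Rightarrow> bool" where
  "self_injective ar A \<longleftrightarrow>
     (\<forall>B h. subalgebra ar B A \<and> homomorphism ar B A h \<longrightarrow>
        (\<exists>k. homomorphism ar A A k \<and> (\<forall>x\<in>univ B. k x = h x)))"

definition injective_in ::
    "('f \<Rightarrow> nat) \<Rightarrow> ('f, 'a) algebra set \<Rightarrow> ('f, 'a) algebra \<Rightarrow> bool" where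
  "injective_in ar K A \<longleftrightarrow> A \<in> K \<and>
     (\<forall>B\<in>K. \<forall>C\<in>K. \<forall>f g. embedding ar B C f \<and> homomorphism ar B A g \<longrightarrow>
        (\<exists>h. homomorphism ar C A h \<and> (\<forall>x\<in>univ B. h (f x) = g x)))"

end

theory Submission
  imports Defs
begin

text \<open>
  Let \<open>S \<le> C\<close> and \<open>g : S \<rightarrow> I\<close> with \<open>I\<close> nontrivial. The kernel of \<open>g\<close> separates \<open>0\<close> and \<open>1\<close>, hence so
  does its extension to \<open>C\<close> given by the congruence extension property, and by Zorn's lemma there
  is a maximal congruence \<open>\<psi>\<close> above it that separates \<open>0\<close> and \<open>1\<close>. A congruence identifying \<open>0\<close> and \<open>1\<close>
  is total, so \<open>C/\<psi>\<close> is simple and embeds into \<open>I\<close>; this gives \<open>u : C \<rightarrow> I\<close> with kernel \<open>\<psi>\<close>.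
  As \<open>g(S)\<close> is simple by the congruence extension property for \<open>I\<close>, the homomorphism
  \<open>g(S) \<rightarrow> I\<close> sending \<open>g x\<close> to \<open>u x\<close> is injective, and self-injectivity extends its inverse
  \<open>u(S) \<rightarrow> g(S)\<close> to an endomorphism \<open>k\<close> of \<open>I\<close>. Then \<open>k \<circ> u\<close> extends \<open>g\<close>.
\<close>

subsection \<open>Homomorphisms and congruences\<close>

lemma homomorphism_in: "homomorphism ar A B h \<Longrightarrow> x \<in> univ A \<Longrightarrow> h x \<in> univ B"
  by (auto simp: homomorphism_def)

lemma homomorphism_oper:
  "homomorphism ar A B h \<Longrightarrow> length xs = ar f \<Longrightarrow> set xs \<subseteq> univ A \<Longrightarrow>
    h (oper A f xs) = oper B f (map h xs)"
  by (auto simp: homomorphism_def)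

lemma algebra_oper:
  "algebra ar A \<Longrightarrow> length xs = ar f \<Longrightarrow> set xs \<subseteq> univ A \<Longrightarrow> oper A f xs \<in> univ A"
  by (auto simp: algebra_def)

lemma homomorphism_comp:
  assumes g: "homomorphism ar A B g" and h: "homomorphism ar B C h"
  shows "homomorphism ar A C (h \<circ> g)"
  unfolding homomorphism_def
proof (intro conjI allI impI)
  show "(h \<circ> g) ` univ A \<subseteq> univ C"
    using homomorphism_in[OF g] homomorphism_in[OF h] by auto
next
  fix f xs assume xs: "length xs = ar f \<and> set xs \<subseteq> univ A"
  then have "set (map g xs) \<subseteq> univ B"
    using homomorphism_in[OF g] by auto
  then show "(h \<circ> g) (oper A f xs) = oper C f (map (h \<circ> g) xs)"
    using xs homomorphism_oper[OF g] homomorphism_oper[OF h, of "map g xs"] by simp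
qed

lemma subuniverse_algebra: "subuniverse ar A S \<Longrightarrow> algebra ar (A\<lparr>univ := S\<rparr>)"
  by (auto simp: subuniverse_def algebra_def)

lemma homomorphism_restrict:
  "homomorphism ar A B h \<Longrightarrow> S \<subseteq> univ A \<Longrightarrow> homomorphism ar (A\<lparr>univ := S\<rparr>) B h"
  unfolding homomorphism_def by auto

lemma map_preimage:
  assumes "set ys \<subseteq> h ` S"
  obtains xs where "ys = map h xs" "set xs \<subseteq> S"
proof
  show "ys = map h (map (inv_into S h) ys)"
    using assms by (auto simp: f_inv_into_f subset_iff intro!: map_idI[symmetric])
  show "set (map (inv_into S h) ys) \<subseteq> S"
    using assms by (auto intro: inv_into_into)
qed

lemma subuniverse_image:
  assumes h: "homomorphism ar A B h" and A: "algebra ar A"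
  shows "subuniverse ar B (h ` univ A)"
  unfolding subuniverse_def
proof (intro conjI allI impI)
  show "h ` univ A \<noteq> {}" using A by (auto simp: algebra_def)
  show "h ` univ A \<subseteq> univ B" using h by (auto simp: homomorphism_def)
next
  fix f ys assume ys: "length ys = ar f \<and> set ys \<subseteq> h ` univ A"
  then obtain xs where xs: "ys = map h xs" "set xs \<subseteq> univ A" using map_preimage[of ys h "univ A"] by blast
  then have "oper B f ys = h (oper A f xs)" using ys homomorphism_oper[OF h] by simp
  then show "oper B f ys \<in> h ` univ A" using xs ys algebra_oper[OF A] by simp
qed

lemma homomorphism_factor:
  assumes p: "homomorphism ar A B p" and u: "homomorphism ar A D u" and A: "algebra ar A"
    and ker: "\<And>x y. x \<in> univ A \<Longrightarrow> y \<in> univ A \<Longrightarrow> p x = p y \<Longrightarrow> u x = u y"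
  obtains w where "homomorphism ar (B\<lparr>univ := p ` univ A\<rparr>) D w" "\<And>x. x \<in> univ A \<Longrightarrow> w (p x) = u x"
proof
  \<comment> \<open>Any preimage under \<open>p\<close> may be chosen: by \<open>ker\<close>,
    \<open>u\<close> takes the same value on all of them.\<close>
  let ?w = "u \<circ> inv_into (univ A) p"
  show w: "?w (p x) = u x" if "x \<in> univ A" for x
    using that ker[of "inv_into (univ A) p (p x)" x] by (simp add: inv_into_into f_inv_into_f)
  show "homomorphism ar (B\<lparr>univ := p ` univ A\<rparr>) D ?w"
    unfolding homomorphism_def
  proof (intro conjI allI impI)
    show "?w ` univ (B\<lparr>univ := p ` univ A\<rparr>) \<subseteq> univ D"
      using w homomorphism_in[OF u] by auto
  next
    fix f ys assume ys: "length ys = ar f \<and> set ys \<subseteq> univ (B\<lparr>univ := p ` univ A\<rparr>)"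
    then have "set ys \<subseteq> p ` univ A" by simp
    then obtain xs where xs: "ys = map p xs" "set xs \<subseteq> univ A" using map_preimage[of ys p "univ A"] by blast
    have "oper B f ys = p (oper A f xs)" using xs ys homomorphism_oper[OF p] by simp
    then have "?w (oper B f ys) = u (oper A f xs)"
      using w algebra_oper[OF A] xs ys by simp
    also have "\<dots> = oper D f (map u xs)" using xs ys homomorphism_oper[OF u] by simp
    also have "map u xs = map ?w ys" using xs w by auto
    finally show "?w (oper (B\<lparr>univ := p ` univ A\<rparr>) f ys) = oper D f (map ?w ys)" by simp
  qed
qed

section \<open>Congruences: pullbacks, kernels and unions of chains\<close>

lemma congruence_rel:
  assumes "congruence ar A \<theta>"
  shows congruence_sub: "(x, y) \<in> \<theta> \<Longrightarrow> x \<in> univ A \<and> y \<in> univ A"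
    and congruence_refl: "x \<in> univ A \<Longrightarrow> (x, x) \<in> \<theta>"
    and congruence_sym: "(x, y) \<in> \<theta> \<Longrightarrow> (y, x) \<in> \<theta>"
    and congruence_trans: "(x, y) \<in> \<theta> \<Longrightarrow> (y, z) \<in> \<theta> \<Longrightarrow> (x, z) \<in> \<theta>"
    and congruence_oper: "length xs = ar f \<Longrightarrow> length ys = ar f \<Longrightarrow>
      (\<And>i. i < ar f \<Longrightarrow> (xs ! i, ys ! i) \<in> \<theta>) \<Longrightarrow> (oper A f xs, oper A f ys) \<in> \<theta>"
proof -
  have eq: "equiv (univ A) \<theta>" using assms by (simp add: congruence_def)
  show "(x, y) \<in> \<theta> \<Longrightarrow> x \<in> univ A \<and> y \<in> univ A" using equiv_type[OF eq] by blast
  show "x \<in> univ A \<Longrightarrow> (x, x) \<in> \<theta>" using eq by (simp add: equiv_def refl_on_def)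
  show "(x, y) \<in> \<theta> \<Longrightarrow> (y, x) \<in> \<theta>" using eq by (simp add: equiv_def sym_def)
  show "(x, y) \<in> \<theta> \<Longrightarrow> (y, z) \<in> \<theta> \<Longrightarrow> (x, z) \<in> \<theta>"
    using eq unfolding equiv_def trans_def by blast
  show "length xs = ar f \<Longrightarrow> length ys = ar f \<Longrightarrow>
      (\<And>i. i < ar f \<Longrightarrow> (xs ! i, ys ! i) \<in> \<theta>) \<Longrightarrow> (oper A f xs, oper A f ys) \<in> \<theta>"
    using assms by (simp add: congruence_def)
qed

lemma congruenceI:
  assumes "\<And>x y. (x, y) \<in> \<theta> \<Longrightarrow> x \<in> univ A \<and> y \<in> univ A"
    and "\<And>x. x \<in> univ A \<Longrightarrow> (x, x) \<in> \<theta>"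
    and "\<And>x y. (x, y) \<in> \<theta> \<Longrightarrow> (y, x) \<in> \<theta>"
    and "\<And>x y z. (x, y) \<in> \<theta> \<Longrightarrow> (y, z) \<in> \<theta> \<Longrightarrow> (x, z) \<in> \<theta>"
    and "\<And>f xs ys. length xs = ar f \<Longrightarrow> length ys = ar f \<Longrightarrow>
      (\<And>i. i < ar f \<Longrightarrow> (xs ! i, ys ! i) \<in> \<theta>) \<Longrightarrow> (oper A f xs, oper A f ys) \<in> \<theta>"
  shows "congruence ar A \<theta>"
proof -
  have "equiv (univ A) \<theta>"
  proof (intro equivI refl_onI symI transI)
    show "\<theta> \<subseteq> univ A \<times> univ A" using assms(1) by auto
  qed (fact assms(2-4))+
  then show ?thesis using assms(5) unfolding congruence_def by blast
qed

lemma congruence_Id_on: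
  assumes A: "algebra ar A" shows "congruence ar A (Id_on (univ A))"
proof (rule congruenceI)
  fix f xs ys
  assume len: "length xs = ar f" "length ys = ar f"
    and xy: "\<And>i. i < ar f \<Longrightarrow> (xs ! i, ys ! i) \<in> Id_on (univ A)"
  have "xs = ys"
  proof (rule nth_equalityI)
    show "xs ! i = ys ! i" if "i < length xs" for i
      using xy[of i] that len by auto
  qed (use len in simp)
  moreover have "set xs \<subseteq> univ A" using len xy by (fastforce simp: in_set_conv_nth)
  ultimately show "(oper A f xs, oper A f ys) \<in> Id_on (univ A)"
    using algebra_oper[OF A] len by auto
qed auto

text \<open>This serves twice: pulling back the diagonal gives kernels, and pulling back along a
  quotient map turns congruences of the quotient into congruences of \<open>A\<close>.\<close>

lemma congruence_vimage:
  assumes h: "homomorphism ar A B h" and A: "algebra ar A" and \<chi>: "congruence ar B \<chi>"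
  shows "congruence ar A {(x, y). x \<in> univ A \<and> y \<in> univ A \<and> (h x, h y) \<in> \<chi>}"
proof (rule congruenceI)
  fix f xs ys
  assume len: "length xs = ar f" "length ys = ar f"
    and xy: "\<And>i. i < ar f \<Longrightarrow>
      (xs ! i, ys ! i) \<in> {(x, y). x \<in> univ A \<and> y \<in> univ A \<and> (h x, h y) \<in> \<chi>}"
  have sub: "set xs \<subseteq> univ A" "set ys \<subseteq> univ A"
    using len xy by (auto simp: in_set_conv_nth)
  have "(oper B f (map h xs), oper B f (map h ys)) \<in> \<chi>"
    using len xy by (intro congruence_oper[OF \<chi>]) auto
  then show "(oper A f xs, oper A f ys) \<in> {(x, y). x \<in> univ A \<and> y \<in> univ A \<and> (h x, h y) \<in> \<chi>}"
    using sub len algebra_oper[OF A] homomorphism_oper[OF h] by simp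
next
  fix x y z
  let ?R = "{(x, y). x \<in> univ A \<and> y \<in> univ A \<and> (h x, h y) \<in> \<chi>}"
  show "(x, x) \<in> ?R" if "x \<in> univ A"
    using that congruence_refl[OF \<chi> homomorphism_in[OF h]] by simp
  show "(y, x) \<in> ?R" if "(x, y) \<in> ?R"
    using that congruence_sym[OF \<chi>] by simp
  show "(x, z) \<in> ?R" if "(x, y) \<in> ?R" "(y, z) \<in> ?R"
    using that congruence_trans[OF \<chi>, of "h x" "h y" "h z"] by simp
qed simp

lemma congruence_kernel:
  assumes h: "homomorphism ar A B h" and A: "algebra ar A" and B: "algebra ar B"
  shows "congruence ar A {(x, y). x \<in> univ A \<and> y \<in> univ A \<and> h x = h y}"
proof -
  have "{(x, y). x \<in> univ A \<and> y \<in> univ A \<and> h x = h y}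
      = {(x, y). x \<in> univ A \<and> y \<in> univ A \<and> (h x, h y) \<in> Id_on (univ B)}"
    using homomorphism_in[OF h] by auto
  then show ?thesis using congruence_vimage[OF h A congruence_Id_on[OF B]] by simp
qed

text \<open>Operations are finitary, so each closure condition involves finitely many pairs of the
  union, and in a chain these already lie in a single member.\<close>

lemma congruence_Union_chain:
  assumes chain: "subset.chain {\<theta>. congruence ar A \<theta>} \<C>" and ne: "\<C> \<noteq> {}"
  shows "congruence ar A (\<Union>\<C>)"
proof -
  have cong: "congruence ar A \<theta>" if "\<theta> \<in> \<C>" for \<theta>
    using that chain by (auto simp: subset.chain_def)
  have common: "\<exists>\<theta>\<in>\<C>. F \<subseteq> \<theta>" if "finite F" "F \<subseteq> \<Union>\<C>" for F
    using finite_subset_Union_chain[OF that ne chain] by blast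
  show ?thesis
  proof (rule congruenceI)
    fix x y z assume "(x, y) \<in> \<Union>\<C>" "(y, z) \<in> \<Union>\<C>"
    then obtain \<theta> where "\<theta> \<in> \<C>" "{(x, y), (y, z)} \<subseteq> \<theta>"
      using common[of "{(x, y), (y, z)}"] by (meson empty_subsetI finite.intros insert_subset)
    then show "(x, z) \<in> \<Union>\<C>"
      using congruence_trans[OF cong[OF \<open>\<theta> \<in> \<C>\<close>], of x y z] by blast
  next
    fix f xs ys
    assume len: "length xs = ar f" "length ys = ar f"
      and xy: "\<And>i. i < ar f \<Longrightarrow> (xs ! i, ys ! i) \<in> \<Union>\<C>"
    \<comment> \<open>For arity 0 the set of pairs is empty; a member of the chain is still
      available because the chain is nonempty.\<close>
    obtain \<theta> where \<theta>: "\<theta> \<in> \<C>" "(\<lambda>i. (xs ! i, ys ! i)) ` {..<ar f} \<subseteq> \<theta>"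
      using common[of "(\<lambda>i. (xs ! i, ys ! i)) ` {..<ar f}"] xy by blast
    have "(oper A f xs, oper A f ys) \<in> \<theta>"
      using len \<theta>(2) by (intro congruence_oper[OF cong[OF \<theta>(1)]]) auto
    then show "(oper A f xs, oper A f ys) \<in> \<Union>\<C>" using \<theta>(1) by blast
  next
    show "x \<in> univ A \<and> y \<in> univ A" if "(x, y) \<in> \<Union>\<C>" for x y
    proof -
      from that obtain \<theta> where \<theta>: "\<theta> \<in> \<C>" "(x, y) \<in> \<theta>" by (elim UnionE)
      then show ?thesis using congruence_sub[OF cong[OF \<theta>(1)] \<theta>(2)] by simp
    qed
    show "(x, x) \<in> \<Union>\<C>" if "x \<in> univ A" for x
    proof -
      from ne obtain \<theta> where \<theta>: "\<theta> \<in> \<C>" by blast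
      then show ?thesis using congruence_refl[OF cong[OF \<theta>] that] by (intro UnionI)
    qed
    show "(y, x) \<in> \<Union>\<C>" if "(x, y) \<in> \<Union>\<C>" for x y
    proof -
      from that obtain \<theta> where \<theta>: "\<theta> \<in> \<C>" "(x, y) \<in> \<theta>" by (elim UnionE)
      then show ?thesis using congruence_sym[OF cong[OF \<theta>(1)] \<theta>(2)] by (intro UnionI)
    qed
  qed
qed

text \<open>Zorn's lemma applies to the congruences above \<open>\<phi>\<close> that omit
  \<open>p\<close>: if no member of a chain contains \<open>p\<close>, neither does the
  union.\<close>

lemma congruence_maximal_avoiding:
  assumes "congruence ar A \<phi>" "p \<notin> \<phi>"
  obtains \<psi> where "congruence ar A \<psi>" "\<phi> \<subseteq> \<psi>" "p \<notin> \<psi>"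
    "\<And>\<chi>. congruence ar A \<chi> \<Longrightarrow> \<psi> \<subseteq> \<chi> \<Longrightarrow> p \<notin> \<chi> \<Longrightarrow> \<chi> = \<psi>"
proof -
  let ?Z = "{\<theta>. congruence ar A \<theta> \<and> \<phi> \<subseteq> \<theta> \<and> p \<notin> \<theta>}"
  have "\<exists>M\<in>?Z. \<forall>X\<in>?Z. M \<subseteq> X \<longrightarrow> X = M"
  proof (rule subset_Zorn_nonempty)
    show "?Z \<noteq> {}" using assms by blast
  next
    fix \<C> assume ne: "\<C> \<noteq> {}" and chain: "subset.chain ?Z \<C>"
    then have "subset.chain {\<theta>. congruence ar A \<theta>} \<C>"
      by (auto simp: subset.chain_def)
    then have "congruence ar A (\<Union>\<C>)" using ne by (rule congruence_Union_chain)
    then show "\<Union>\<C> \<in> ?Z" using ne chain by (auto simp: subset.chain_def)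
  qed
  then obtain \<psi> where \<psi>: "\<psi> \<in> ?Z" and max: "\<forall>\<chi>\<in>?Z. \<psi> \<subseteq> \<chi> \<longrightarrow> \<chi> = \<psi>"
    by (elim bexE)
  show ?thesis
  proof (rule that)
    show "\<chi> = \<psi>" if "congruence ar A \<chi>" "\<psi> \<subseteq> \<chi>" "p \<notin> \<chi>" for \<chi>
      using \<psi> bspec[OF max, of \<chi>] that by auto
  qed (use \<psi> in simp_all)
qed

text \<open>A congruence of \<open>B\<close> is the restriction of one of \<open>I\<close>, which is
  the diagonal or the total relation, and both of these restrict to relations of the same
  kind.\<close>

lemma subalgebra_simple:
  assumes I: "simple ar I" "CEP ar I" and B: "subalgebra ar B I"
  shows "simple ar B"
  unfolding simple_def
proof (intro allI impI)
  fix \<theta> assume "congruence ar B \<theta>"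
  then obtain \<phi> where \<phi>: "congruence ar I \<phi>" "\<theta> = \<phi> \<inter> univ B \<times> univ B"
    using I(2) B unfolding CEP_def by blast
  have "univ B \<subseteq> univ I" using B by (auto simp: subalgebra_def subuniverse_def)
  then show "\<theta> = Id_on (univ B) \<or> \<theta> = univ B \<times> univ B"
    using I(1) \<phi> unfolding simple_def by blast
qed

subsection \<open>Terms\<close>

lemma eval_in:
  assumes "algebra ar A" "range v \<subseteq> univ A"
  shows "wf_trm ar t \<Longrightarrow> eval A v t \<in> univ A"
proof (induction t)
  case (App f ts)
  then show ?case using assms by (auto simp: list_all_iff intro!: algebra_oper[OF assms(1)])
qed (use assms in auto)

lemma homomorphism_eval:
  assumes A: "algebra ar A" and v: "range v \<subseteq> univ A" and h: "homomorphism ar A B h"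
  shows "wf_trm ar t \<Longrightarrow> h (eval A v t) = eval B (h \<circ> v) t"
proof (induction t)
  case (App f ts)
  have "set (map (eval A v) ts) \<subseteq> univ A"
    using App.prems eval_in[OF A v] by (auto simp: list_all_iff)
  then have "h (eval A v (App f ts)) = oper B f (map h (map (eval A v) ts))"
    using App.prems homomorphism_oper[OF h, of "map (eval A v) ts"] by simp
  also have "map h (map (eval A v) ts) = map (eval B (h \<circ> v)) ts"
    using App by (auto simp: list_all_iff comp_def)
  finally show ?case by (simp add: comp_def)
qed simp

text \<open>Evaluation uses only the operations. Hence constants computed in an algebra and in a
  subalgebra agree, so their values lie in every subuniverse.\<close>

lemma eval_univ_update: "eval (A\<lparr>univ := S\<rparr>) v t = eval A v t"
proof (induction t)
  case (App f ts)
  then have "map (eval (A\<lparr>univ := S\<rparr>) v) ts = map (eval A v) ts" by simp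
  then show ?case by (simp del: map_eq_conv)
qed simp

subsection \<open>Quotients\<close>

text \<open>The quotient must live in the same type, hence its carrier is a set of representatives.\<close>

definition quot_rep :: "('a \<times> 'a) set \<Rightarrow> 'a \<Rightarrow> 'a" where
  "quot_rep \<psi> x = (SOME y. (x, y) \<in> \<psi>)"

definition quot :: "('f, 'a) algebra \<Rightarrow> ('a \<times> 'a) set \<Rightarrow> ('f, 'a) algebra" where
  "quot A \<psi> = \<lparr>univ = quot_rep \<psi> ` univ A, oper = \<lambda>f xs. quot_rep \<psi> (oper A f xs)\<rparr>"

context
  fixes ar :: "'f \<Rightarrow> nat" and A :: "('f, 'a) algebra" and \<psi> :: "('a \<times> 'a) set"
  assumes A: "algebra ar A" and \<psi>: "congruence ar A \<psi>"
begin

lemma quot_rep_rel: "x \<in> univ A \<Longrightarrow> (x, quot_rep \<psi> x) \<in> \<psi>"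
  unfolding quot_rep_def by (rule someI) (rule congruence_refl[OF \<psi>])

lemma quot_rep_eq_iff:
  assumes "x \<in> univ A" "y \<in> univ A"
  shows "quot_rep \<psi> x = quot_rep \<psi> y \<longleftrightarrow> (x, y) \<in> \<psi>"
proof
  assume "quot_rep \<psi> x = quot_rep \<psi> y"
  then show "(x, y) \<in> \<psi>"
    using quot_rep_rel assms congruence_sym[OF \<psi>] congruence_trans[OF \<psi>] by metis
next
  assume "(x, y) \<in> \<psi>"
  \<comment> \<open>Related elements define the same predicate under \<open>SOME\<close>, so the
    same representative is chosen for both.\<close>
  then have "(x, z) \<in> \<psi> \<longleftrightarrow> (y, z) \<in> \<psi>" for z
    using congruence_sym[OF \<psi>] congruence_trans[OF \<psi>] by blast
  then show "quot_rep \<psi> x = quot_rep \<psi> y" by (simp add: quot_rep_def)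
qed

lemma quot_rep_homomorphism: "homomorphism ar A (quot A \<psi>) (quot_rep \<psi>)"
  unfolding homomorphism_def
proof (intro conjI allI impI)
  fix f xs assume xs: "length xs = ar f \<and> set xs \<subseteq> univ A"
  have "set (map (quot_rep \<psi>) xs) \<subseteq> univ A"
    using xs congruence_sub[OF \<psi> quot_rep_rel] by auto
  \<comment> \<open>An operation of the quotient acts on representatives and then normalizes the
    result. Compatibility of \<open>\<psi>\<close> makes the outcome independent of replacing
    arguments by their representatives.\<close>
  moreover have "(oper A f xs, oper A f (map (quot_rep \<psi>) xs)) \<in> \<psi>"
  proof (rule congruence_oper[OF \<psi>])
    show "(xs ! i, map (quot_rep \<psi>) xs ! i) \<in> \<psi>" if "i < ar f" for i
      using that xs quot_rep_rel[of "xs ! i"] by (auto simp: subset_iff)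
  qed (use xs in auto)
  ultimately show "quot_rep \<psi> (oper A f xs) = oper (quot A \<psi>) f (map (quot_rep \<psi>) xs)"
    using xs algebra_oper[OF A] by (simp add: quot_def quot_rep_eq_iff)
qed (simp add: quot_def)

lemma univ_quot: "univ (quot A \<psi>) = quot_rep \<psi> ` univ A"
  by (simp add: quot_def)

lemma quot_algebra: "algebra ar (quot A \<psi>)"
  using subuniverse_image[OF quot_rep_homomorphism A]
  unfolding subuniverse_def algebra_def univ_quot by blast

text \<open>Every valuation in the quotient lifts to a valuation in \<open>A\<close>; there the
  equation holds, and the quotient map carries it back.\<close>

lemma quot_satisfies:
  assumes sat: "satisfies A (s, t)" and wf: "wf_trm ar s" "wf_trm ar t"
  shows "satisfies (quot A \<psi>) (s, t)"
  unfolding satisfies_def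
proof (intro allI impI)
  fix v :: "nat \<Rightarrow> 'a" assume "range v \<subseteq> univ (quot A \<psi>)"
  then have v: "v n \<in> quot_rep \<psi> ` univ A" for n by (auto simp: univ_quot)
  define v' where "v' n = inv_into (univ A) (quot_rep \<psi>) (v n)" for n
  have v': "range v' \<subseteq> univ A" and vv': "v = quot_rep \<psi> \<circ> v'"
    using v by (auto simp: v'_def inv_into_into f_inv_into_f)
  have "eval A v' s = eval A v' t" using sat v' by (simp add: satisfies_def)
  then show "eval (quot A \<psi>) v (fst (s, t)) = eval (quot A \<psi>) v (snd (s, t))"
    using wf homomorphism_eval[OF A v' quot_rep_homomorphism] vv' by (metis fst_conv snd_conv)
qed

end

lemma variety_algebra: "variety ar K \<Longrightarrow> A \<in> K \<Longrightarrow> algebra ar A"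
  by (auto simp: variety_def)

lemma variety_quot:
  assumes K: "variety ar K" and A: "A \<in> K" and \<psi>: "congruence ar A \<psi>"
  shows "quot A \<psi> \<in> K"
proof -
  have alg: "algebra ar A" using variety_algebra[OF K A] .
  obtain E where E: "\<forall>(s, t)\<in>E. wf_trm ar s \<and> wf_trm ar t"
    and KE: "K = {A. algebra ar A \<and> (\<forall>e\<in>E. satisfies A e)}"
    using K unfolding variety_def by (elim exE conjE)
  have "satisfies (quot A \<psi>) e" if "e \<in> E" for e
    using that E A quot_satisfies[OF alg \<psi>] unfolding KE by (cases e) auto
  then show ?thesis using quot_algebra[OF alg \<psi>] by (simp add: KE)
qed

subsection \<open>Distinguished constants and injectivity\<close>

text \<open>The quotient belongs to the variety and satisfies 0 = 1, so it has only one element.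
  This is how distinguished constants make separation of a single pair control properness of a
  congruence.\<close>

lemma congruence_total:
  assumes K: "variety ar K" and dc: "distinguished_constants ar K c0 c1" and A: "A \<in> K"
    and \<psi>: "congruence ar A \<psi>" and v: "range v \<subseteq> univ A"
    and eq: "(eval A v c0, eval A v c1) \<in> \<psi>"
  shows "\<psi> = univ A \<times> univ A"
proof -
  let ?q = "quot_rep \<psi>"
  have alg: "algebra ar A" using variety_algebra[OF K A] .
  note q = quot_rep_homomorphism[OF alg \<psi>]
  have wf: "wf_trm ar c0" "wf_trm ar c1"
    using dc by (auto simp: distinguished_constants_def constant_trm_def)
  have "?q (eval A v c0) = ?q (eval A v c1)"
    using eq quot_rep_eq_iff[OF alg \<psi>] congruence_sub[OF \<psi> eq] by simp
  then have "eval (quot A \<psi>) (?q \<circ> v) c0 = eval (quot A \<psi>) (?q \<circ> v) c1"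
    using homomorphism_eval[OF alg v q] wf by simp
  moreover have "range (?q \<circ> v) \<subseteq> univ (quot A \<psi>)"
    using v by (auto simp: quot_def)
  ultimately have "\<not> nontrivial (quot A \<psi>)"
    using dc variety_quot[OF K A \<psi>] unfolding distinguished_constants_def by blast
  then have total: "(x, y) \<in> \<psi>" if "x \<in> univ A" "y \<in> univ A" for x y
    using that quot_rep_eq_iff[OF alg \<psi>] unfolding nontrivial_def quot_def by auto
  show ?thesis
  proof (intro equalityI subrelI)
    show "(x, y) \<in> univ A \<times> univ A" if "(x, y) \<in> \<psi>" for x y
      using congruence_sub[OF \<psi> that] by simp
  qed (use total in simp)
qed

text \<open>This is the correspondence between congruences of the quotient and congruences of
  \<open>A\<close> above \<open>\<psi>\<close>, of which only \<open>\<psi>\<close> and the total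
  relation exist.\<close>

lemma quot_maximal_simple:
  assumes A: "algebra ar A" and \<psi>: "congruence ar A \<psi>"
    and max: "\<And>\<chi>. congruence ar A \<chi> \<Longrightarrow> \<psi> \<subseteq> \<chi> \<Longrightarrow> \<chi> = \<psi> \<or> \<chi> = univ A \<times> univ A"
  shows "simple ar (quot A \<psi>)"
  unfolding simple_def
proof (intro allI impI)
  let ?q = "quot_rep \<psi>"
  fix \<chi> assume \<chi>: "congruence ar (quot A \<psi>) \<chi>"
  define \<chi>' where "\<chi>' = {(x, y). x \<in> univ A \<and> y \<in> univ A \<and> (?q x, ?q y) \<in> \<chi>}"
  have "congruence ar A \<chi>'"
    unfolding \<chi>'_def by (rule congruence_vimage[OF quot_rep_homomorphism[OF A \<psi>] A \<chi>])
  moreover have "\<psi> \<subseteq> \<chi>'"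
  proof clarify
    fix x y assume xy: "(x, y) \<in> \<psi>"
    then have "x \<in> univ A" "y \<in> univ A" "?q x = ?q y"
      using congruence_sub[OF \<psi> xy] quot_rep_eq_iff[OF A \<psi>] by auto
    then show "(x, y) \<in> \<chi>'"
      using congruence_refl[OF \<chi>, of "?q y"] by (auto simp: \<chi>'_def univ_quot[OF A \<psi>])
  qed
  ultimately have "\<chi>' = \<psi> \<or> \<chi>' = univ A \<times> univ A" by (rule max)
  \<comment> \<open>Surjectivity of the quotient map recovers \<open>\<chi>\<close> from its
    pullback, so it remains to compute the images of the two candidates for
    \<open>\<chi>'\<close>.\<close>
  moreover have "\<chi> = map_prod ?q ?q ` \<chi>'"
  proof
    show "\<chi> \<subseteq> map_prod ?q ?q ` \<chi>'"
      using congruence_sub[OF \<chi>] by (force simp: \<chi>'_def univ_quot[OF A \<psi>])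
    show "map_prod ?q ?q ` \<chi>' \<subseteq> \<chi>" by (auto simp: \<chi>'_def)
  qed
  moreover have "map_prod ?q ?q ` \<psi> = Id_on (univ (quot A \<psi>))"
  proof
    show "map_prod ?q ?q ` \<psi> \<subseteq> Id_on (univ (quot A \<psi>))"
      using congruence_sub[OF \<psi>] quot_rep_eq_iff[OF A \<psi>] by (force simp: univ_quot[OF A \<psi>])
    show "Id_on (univ (quot A \<psi>)) \<subseteq> map_prod ?q ?q ` \<psi>"
      using congruence_refl[OF \<psi>] by (force simp: univ_quot[OF A \<psi>])
  qed
  moreover have "map_prod ?q ?q ` (univ A \<times> univ A) = univ (quot A \<psi>) \<times> univ (quot A \<psi>)"
    by (simp add: univ_quot[OF A \<psi>] map_prod_surj_on)
  ultimately show "\<chi> = Id_on (univ (quot A \<psi>)) \<or> \<chi> = univ (quot A \<psi>) \<times> univ (quot A \<psi>)"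
    by metis
qed

section \<open>Extension of homomorphisms from subalgebras and along embeddings\<close>

lemma extend_from_subuniverse:
  fixes K :: "('f, 'a) algebra set"
  assumes K: "variety ar K" and cep: "\<forall>A\<in>K. CEP ar A"
    and dc: "distinguished_constants ar K c0 c1"
    and ms: "maximum_simple ar K I" and si: "self_injective ar I"
    and C: "C \<in> K" and S: "subuniverse ar C S" and g: "homomorphism ar (C\<lparr>univ := S\<rparr>) I g"
  shows "\<exists>h. homomorphism ar C I h \<and> (\<forall>x\<in>S. h x = g x)"
proof (cases "nontrivial I")
  \<comment> \<open>The definition of \<open>maximum_simple\<close> admits a one-element
    \<open>I\<close>; then the constant map is the extension.\<close>
  case False
  have algI: "algebra ar I" using ms variety_algebra[OF K] by (simp add: maximum_simple_def)
  obtain i where i: "univ I = {i}"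
    using False algI unfolding nontrivial_def algebra_def by blast
  have "oper I f (map (\<lambda>_. i) xs) = i" if "length xs = ar f" for f and xs :: "'a list"
    using algebra_oper[OF algI, of "map (\<lambda>_. i) xs" f] that i by auto
  then have "homomorphism ar C I (\<lambda>_. i)"
    using i by (auto simp: homomorphism_def)
  moreover have "g x = i" if "x \<in> S" for x using that homomorphism_in[OF g] i by auto
  ultimately show ?thesis by blast
next
  case True
  have I: "I \<in> K" and simpI: "simple ar I" using ms by (auto simp: maximum_simple_def)
  note algC = variety_algebra[OF K C] and algI = variety_algebra[OF K I]
  let ?B = "C\<lparr>univ := S\<rparr>"
  have SC: "S \<subseteq> univ C" using S by (simp add: subuniverse_def)
  have algB: "algebra ar ?B" using subuniverse_algebra[OF S] .
  have wf: "wf_trm ar c0" "wf_trm ar c1"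
    using dc by (auto simp: distinguished_constants_def constant_trm_def)
  obtain s where s: "s \<in> S" using S by (auto simp: subuniverse_def)
  \<comment> \<open>Constant terms are evaluated under some valuation, and one with values in
    \<open>S\<close> works for both \<open>C\<close> and its subalgebra.\<close>
  define v where "v = (\<lambda>_::nat. s)"
  have vB: "range v \<subseteq> univ ?B" and vC: "range v \<subseteq> univ C" using s SC by (auto simp: v_def)
  define a b where "a = eval C v c0" and "b = eval C v c1"
  have aB: "a = eval ?B v c0" and bB: "b = eval ?B v c1"
    by (simp_all add: a_def b_def eval_univ_update)
  have abS: "a \<in> S" "b \<in> S"
    using eval_in[OF algB vB] wf unfolding aB bB by auto
  have "range (g \<circ> v) \<subseteq> univ I" using vB homomorphism_in[OF g] by auto
  \<comment> \<open>Homomorphisms preserve the values of terms, so \<open>g a\<close> and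
    \<open>g b\<close> are the constants 0 and 1 of the nontrivial algebra \<open>I\<close>.\<close>
  then have gab: "g a \<noteq> g b"
    using dc I True homomorphism_eval[OF algB vB g] wf
    unfolding aB bB distinguished_constants_def by metis

  have "congruence ar ?B {(x, y). x \<in> S \<and> y \<in> S \<and> g x = g y}"
    using congruence_kernel[OF g algB algI] by simp
  moreover have "subalgebra ar ?B C" using S by (auto simp: subalgebra_def)
  ultimately obtain \<phi> where \<phi>: "congruence ar C \<phi>"
    and ker: "{(x, y). x \<in> S \<and> y \<in> S \<and> g x = g y} = \<phi> \<inter> univ ?B \<times> univ ?B"
    using cep C unfolding CEP_def by meson
  have "(a, b) \<notin> \<phi>" using gab abS ker by auto
  then obtain \<psi> where \<psi>: "congruence ar C \<psi>" "\<phi> \<subseteq> \<psi>" "(a, b) \<notin> \<psi>"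
    and max: "\<And>\<chi>. congruence ar C \<chi> \<Longrightarrow> \<psi> \<subseteq> \<chi> \<Longrightarrow> (a, b) \<notin> \<chi> \<Longrightarrow> \<chi> = \<psi>"
    using congruence_maximal_avoiding[OF \<phi>] by metis
  \<comment> \<open>A congruence above \<open>\<psi>\<close> that omits \<open>(a, b)\<close> equals
    \<open>\<psi>\<close> by maximality; one that contains it is total by
    \<open>congruence_total\<close>.\<close>
  have "simple ar (quot C \<psi>)"
    using max congruence_total[OF K dc C _ vC]
    by (intro quot_maximal_simple[OF algC \<psi>(1)]) (auto simp: a_def b_def)
  moreover have "nontrivial (quot C \<psi>)"
    using \<psi>(3) abS SC quot_rep_eq_iff[OF algC \<psi>(1), of a b]
    unfolding nontrivial_def univ_quot[OF algC \<psi>(1)] by blast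
  ultimately obtain e where e: "homomorphism ar (quot C \<psi>) I e" "inj_on e (univ (quot C \<psi>))"
    using ms variety_quot[OF K C \<psi>(1)] unfolding maximum_simple_def embedding_def by blast
  define u where "u = e \<circ> quot_rep \<psi>"
  have u: "homomorphism ar C I u"
    unfolding u_def by (rule homomorphism_comp[OF quot_rep_homomorphism[OF algC \<psi>(1)] e(1)])
  have u_iff: "u x = u y \<longleftrightarrow> (x, y) \<in> \<psi>" if "x \<in> univ C" "y \<in> univ C" for x y
    using that quot_rep_eq_iff[OF algC \<psi>(1)] e(2)
    by (simp add: u_def univ_quot[OF algC \<psi>(1)] inj_on_eq_iff)
  have uB: "homomorphism ar ?B I u" using homomorphism_restrict[OF u SC] .

  \<comment> \<open>On \<open>S\<close> the kernel of \<open>g\<close> is the restriction of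
    \<open>\<phi>\<close>, which is contained in \<open>\<psi>\<close>, the kernel of
    \<open>u\<close>.\<close>
  have gu: "u x = u y" if "x \<in> univ ?B" "y \<in> univ ?B" "g x = g y" for x y
  proof -
    have "(x, y) \<in> {(x, y). x \<in> S \<and> y \<in> S \<and> g x = g y}" using that by simp
    then have "(x, y) \<in> \<psi>" unfolding ker using \<psi>(2) by blast
    then show ?thesis using u_iff[of x y] that SC by auto
  qed
  obtain w where "homomorphism ar (I\<lparr>univ := g ` univ ?B\<rparr>) I w"
    and "\<And>x. x \<in> univ ?B \<Longrightarrow> w (g x) = u x"
    by (rule homomorphism_factor[OF g uB algB]) (rule gu that; assumption)+
  then have w: "homomorphism ar (I\<lparr>univ := g ` S\<rparr>) I w"
    and wg: "\<And>x. x \<in> S \<Longrightarrow> w (g x) = u x" by simp_all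
  have T: "subuniverse ar I (g ` S)" using subuniverse_image[OF g algB] by simp
  \<comment> \<open>\<open>N\<close> is the kernel of \<open>w\<close>. Simplicity of g(S) leaves
    two possibilities, and the total one fails because \<open>u\<close> separates \<open>a\<close>
    and \<open>b\<close>. So \<open>w\<close> is injective, which turns the inclusion of kernels in
    \<open>gu\<close> into the equality needed for \<open>ug\<close>.\<close>
  define N where "N = {(x, y). x \<in> g ` S \<and> y \<in> g ` S \<and> w x = w y}"
  have "simple ar (I\<lparr>univ := g ` S\<rparr>)"
    using subalgebra_simple[OF simpI] cep I T unfolding subalgebra_def by blast
  moreover have "congruence ar (I\<lparr>univ := g ` S\<rparr>) N"
    using congruence_kernel[OF w subuniverse_algebra[OF T] algI] by (simp add: N_def)
  ultimately have "N = Id_on (g ` S) \<or> N = g ` S \<times> g ` S"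
    by (auto simp: simple_def)
  moreover have "(g a, g b) \<notin> N"
    using wg[OF abS(1)] wg[OF abS(2)] abS u_iff[of a b] SC \<psi>(3) by (auto simp: N_def)
  moreover have "(g a, g b) \<in> g ` S \<times> g ` S" using abS by simp
  ultimately have w_inj: "N = Id_on (g ` S)" by metis
  have ug: "g x = g y" if "x \<in> univ ?B" "y \<in> univ ?B" "u x = u y" for x y
  proof -
    have "(g x, g y) \<in> N"
      using that wg[of x] wg[of y] by (simp add: N_def)
    then show ?thesis unfolding w_inj by auto
  qed
  \<comment> \<open>The roles of \<open>g\<close> and \<open>u\<close> are now exchanged:
    \<open>w'\<close> inverts \<open>w\<close> on u(S), and self-injectivity applies to it because
    u(S) is a subalgebra of \<open>I\<close>.\<close>
  obtain w' where "homomorphism ar (I\<lparr>univ := u ` univ ?B\<rparr>) I w'"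
    and "\<And>x. x \<in> univ ?B \<Longrightarrow> w' (u x) = g x"
    by (rule homomorphism_factor[OF uB g algB]) (rule ug that; assumption)+
  then have w': "homomorphism ar (I\<lparr>univ := u ` S\<rparr>) I w'"
    and wu: "\<And>x. x \<in> S \<Longrightarrow> w' (u x) = g x" by simp_all
  have "subuniverse ar I (u ` S)" using subuniverse_image[OF uB algB] by simp
  then have "subalgebra ar (I\<lparr>univ := u ` S\<rparr>) I" unfolding subalgebra_def by blast
  then obtain k where k: "homomorphism ar I I k" "\<And>x. x \<in> u ` S \<Longrightarrow> k x = w' x"
    using si w' unfolding self_injective_def by fastforce
  show ?thesis
    using homomorphism_comp[OF u k(1)] k(2) wu by (intro exI[of _ "k \<circ> u"]) auto
qed

theorem theorem2p4:
  fixes ar :: "'f \<Rightarrow> nat"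
    and K :: "('f, 'a) algebra set"
    and I :: "('f, 'a) algebra"
    and c0 c1 :: "'f trm"
  assumes "variety ar K"
    and "\<forall>A\<in>K. CEP ar A"
    and "distinguished_constants ar K c0 c1"
    and "maximum_simple ar K I"
    and "self_injective ar I"
  shows "injective_in ar K I"
  unfolding injective_in_def
proof (intro conjI ballI allI impI)
  show "I \<in> K" using assms(4) by (simp add: maximum_simple_def)
next
  fix B C f g
  assume B: "B \<in> K" and C: "C \<in> K" and fg: "embedding ar B C f \<and> homomorphism ar B I g"
  have f: "homomorphism ar B C f" "inj_on f (univ B)" and g: "homomorphism ar B I g"
    using fg by (auto simp: embedding_def)
  note algB = variety_algebra[OF assms(1) B]
  \<comment> \<open>Injectivity of \<open>f\<close> makes the factorization condition trivial, so
    \<open>g\<close> transfers to the subalgebra f(B) of \<open>C\<close> and only extension from a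
    subalgebra remains.\<close>
  obtain g' where g': "homomorphism ar (C\<lparr>univ := f ` univ B\<rparr>) I g'"
    and g'f: "\<And>x. x \<in> univ B \<Longrightarrow> g' (f x) = g x"
    using homomorphism_factor[OF f(1) g algB] f(2) by (metis inj_onD)
  show "\<exists>h. homomorphism ar C I h \<and> (\<forall>x\<in>univ B. h (f x) = g x)"
    using extend_from_subuniverse[OF assms C subuniverse_image[OF f(1) algB] g'] g'f by auto
qed

end
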